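(* Let $\mathcal{Z}$ be a measurable space, $P$ a probability distribution on $\mathcal{Z}\times\mathcal{Z}$, $\mu$ a $\sigma$-finite base measure on $\mathcal{Z}$, and $Q$ an ensembling channel on $\mathcal{Z}$ such that $Q(\cdot\mid z)$ has a density with respect to $\mu$ for every $z\in\mathcal{Z}$. Let $\mathcal{H}$ be a separable (real) Hilbert space and let $\mathcal{W}\subseteq\mathcal{H}$ be a convex and closed subset with $\mathrm{rad}_{\mathcal{H}}(\mathcal{W})<\infty$. Then for any (measurable) $\mathcal{A}:\mathcal{Z}\to\mathcal{W}$, \[\beta^2_P(\mathcal{A}_Q)\leq\mathrm{rad}_{\mathcal{H}}(\mathcal{W})^2\cdot\|T_{P,Q}\|_{L_\infty(\mathcal{H})\to L_1(\mathcal{H})}.\]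
   Context: An ensembling channel $Q$ is a Markov kernel on $\mathcal{Z}$: for each $z\in\mathcal{Z}$, $Q(\cdot\mid z)$ is a probability distribution on $\mathcal{Z}$. Its density with respect to $\mu$ is also denoted $Q(\cdot\mid z)$, and the map $(w,z)\mapsto Q(w\mid z)$ is taken jointly measurable. The radius is $\mathrm{rad}_{\mathcal{H}}(\mathcal{W})=\inf_{w\in\mathcal{W}}\sup_{w'\in\mathcal{W}}\|w-w'\|_{\mathcal{H}}$. The ensembled algorithm is $\mathcal{A}_Q(z)=\mathbb{E}_{Z'\sim Q(\cdot\mid z)}[\mathcal{A}(Z')]$ (an $\mathcal{H}$-valued expectation), and for $\mathcal{B}:\mathcal{Z}\to\mathcal{W}$ the stability parameter is $\beta_P^2(\mathcal{B})=\mathbb{E}_{(Z,Z')\sim P}\big[\|\mathcal{B}(Z)-\mathcal{B}(Z')\|_{\mathcal{H}}^2\big]$. The kernel is \[K_{P,Q}(z,z')=\mathbb{E}_{(Z_0,Z_1)\sim P}\big[(Q(z\mid Z_0)-Q(z\mid Z_1))\,(Q(z'\mid Z_0)-Q(z'\mid Z_1))\big],\] and for bounded measurable $f:\mathcal{Z}\to\mathcal{H}$, $[T_{P,Q}f](z)=\int_{\mathcal{Z}}K_{P,Q}(z,z')f(z')\,d\mu(z')\in\mathcal{H}$. The operator norm is $\|T_{P,Q}\|_{L_\infty(\mathcal{H})\to L_1(\mathcal{H})}=\sup\{\|T_{P,Q}f\|_{L_1(\mathcal{H})}: f:\mathcal{Z}\to\mathcal{H}\text{ measurable},\ \|f\|_{L_\infty(\mathcal{H})}\leq1\}$,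 where $\|f\|_{L_1(\mathcal{H})}=\int_{\mathcal{Z}}\|f(z)\|_{\mathcal{H}}\,d\mu(z)$ and $\|f\|_{L_\infty(\mathcal{H})}=\sup_{z\in\mathcal{Z}}\|f(z)\|_{\mathcal{H}}$. *)

theory Defs
  imports "HOL-Probability.Probability"
begin

text \<open>
  The measurable space \<open>Z\<close> is the one underlying the base measure \<open>\<mu>\<close>.  All quantities that are
  suprema or expectations of nonnegative functions live in \<open>ennreal\<close>, so that no finiteness is
  presupposed and no default value is taken.
\<close>

definition radius :: "'h::real_normed_vector set \<Rightarrow> ennreal" where
  "radius W = (INF w\<in>W. SUP w'\<in>W. ennreal (norm (w - w')))"

definition ensembled ::
    "('z \<Rightarrow> 'z measure) \<Rightarrow> ('z \<Rightarrow> 'h) \<Rightarrow> 'z \<Rightarrow> 'h::{banach, second_countable_topology}" where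
  "ensembled Q A z = (\<integral>z'. A z' \<partial>Q z)"

text \<open>The squared stability parameter \<open>\<beta>\<^sub>P\<^sup>2(B)\<close>.\<close>

definition stability_sq :: "('z \<times> 'z) measure \<Rightarrow> ('z \<Rightarrow> 'h::real_normed_vector) \<Rightarrow> ennreal" where
  "stability_sq P B = (\<integral>\<^sup>+(z, z'). ennreal ((norm (B z - B z'))\<^sup>2) \<partial>P)"

text \<open>
  \<open>q w z\<close> stands for the density \<open>Q(w | z)\<close>.  The expectation below exists for
  \<open>\<mu> \<Otimes> \<mu>\<close>-almost all \<open>(z, z')\<close>, and the integral defining \<open>integral_op\<close> for almost all \<open>z\<close>;
  on the exceptional null sets both take the value 0 of the Bochner integral.
\<close>

definition kernel :: "('z \<times> 'z) measure \<Rightarrow> ('z \<Rightarrow> 'z \<Rightarrow> real) \<Rightarrow> 'z \<Rightarrow> 'z \<Rightarrow> real" where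
  "kernel P q z z' = (\<integral>(z0, z1). (q z z0 - q z z1) * (q z' z0 - q z' z1) \<partial>P)"

definition integral_op ::
    "'z measure \<Rightarrow> ('z \<times> 'z) measure \<Rightarrow> ('z \<Rightarrow> 'z \<Rightarrow> real) \<Rightarrow>
     ('z \<Rightarrow> 'h) \<Rightarrow> 'z \<Rightarrow> 'h::{banach, second_countable_topology}" where
  "integral_op \<mu> P q f z = (\<integral>z'. kernel P q z z' *\<^sub>R f z' \<partial>\<mu>)"

definition L1_norm :: "'z measure \<Rightarrow> ('z \<Rightarrow> 'h::real_normed_vector) \<Rightarrow> ennreal" where
  "L1_norm \<mu> f = (\<integral>\<^sup>+z. ennreal (norm (f z)) \<partial>\<mu>)"

text \<open>A true supremum over the space, not an essential supremum.\<close>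

definition Linf_norm :: "'z measure \<Rightarrow> ('z \<Rightarrow> 'h::real_normed_vector) \<Rightarrow> ennreal" where
  "Linf_norm \<mu> f = (SUP z\<in>space \<mu>. ennreal (norm (f z)))"

definition opnorm_Linf_L1 ::
    "'z measure \<Rightarrow> (('z \<Rightarrow> 'h) \<Rightarrow> 'z \<Rightarrow> 'h::real_normed_vector) \<Rightarrow> ennreal" where
  "opnorm_Linf_L1 \<mu> T =
     (SUP f\<in>{f \<in> borel_measurable \<mu>. Linf_norm \<mu> f \<le> 1}. L1_norm \<mu> (T f))"

end

theory Submission
  imports Defs
begin

text \<open>
  Fix \<open>c \<in> W\<close> and \<open>r > 0\<close> with \<open>\<parallel>w - c\<parallel> \<le> r\<close> on \<open>W\<close>, and put \<open>g = (A - c) / r\<close>, so that \<open>\<parallel>g\<parallel> \<le> 1\<close>.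
  Write \<open>D p w = Q(w | z\<^sub>0) - Q(w | z\<^sub>1)\<close> for \<open>p = (z\<^sub>0, z\<^sub>1)\<close>.  Since \<open>D p\<close> has integral 0, the
  constant \<open>c\<close> drops out and
  \<open>A\<^sub>Q z\<^sub>0 - A\<^sub>Q z\<^sub>1 = r \<integral> D p w g w d\<mu>(w)\<close>.  Expanding the squared norm as a double integral and
  exchanging the expectation over \<open>P\<close> with the two integrals over \<open>\<mu>\<close> gives
  \<open>\<beta>\<^sub>P\<^sup>2(A\<^sub>Q) = r\<^sup>2 \<integral> \<langle>g w, (T g) w\<rangle> d\<mu>(w) \<le> r\<^sup>2 \<parallel>T g\<parallel>\<^sub>1 \<le> r\<^sup>2 \<parallel>T\<parallel>\<close>
  (lemmas \<open>expectation_sq_eq_quadratic_form\<close> and \<open>expectation_sq_le_opnorm\<close>).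

  The exchange is justified because \<open>\<integral> \<bar>D p w\<bar> d\<mu>(w) \<le> 2\<close>, so that \<open>D p w D p w'\<close> is integrable
  over \<open>P \<Otimes> \<mu> \<Otimes> \<mu>\<close> with integral norm at most 4.  The same bound shows that the operator norm is
  finite, which allows \<open>r\<close> to decrease to the radius of \<open>W\<close>, whether or not the radius is attained
  and also when it is 0.
\<close>

section \<open>Differences of channel densities\<close>

text \<open>Integrability is not needed, since the Bochner integral of a non-integrable function is 0.\<close>

lemma norm_integral_le_nn_integral_norm:
  fixes f :: "'a \<Rightarrow> 'b::{banach, second_countable_topology}"
  shows "ennreal (norm (\<integral>x. f x \<partial>M)) \<le> (\<integral>\<^sup>+x. ennreal (norm (f x)) \<partial>M)"
  by (cases "integrable M f") (auto simp: integral_norm_bound_ennreal not_integrable_integral_eq)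

text \<open>
  A probability measure \<open>P\<close> on pairs together with a jointly measurable family of probability
  densities \<open>w \<mapsto> q w z\<close> with respect to \<open>\<mu>\<close>, one for each \<open>z\<close>; the distribution with this density
  is \<open>Q(\<cdot> | z)\<close>.
\<close>

locale channel_density =
  fixes \<mu> :: "'z measure" and P :: "('z \<times> 'z) measure" and q :: "'z \<Rightarrow> 'z \<Rightarrow> real"
  assumes sigma_finite_base: "sigma_finite_measure \<mu>"
    and prob_P: "prob_space P"
    and sets_P: "sets P = sets (\<mu> \<Otimes>\<^sub>M \<mu>)"
    and density_measurable: "(\<lambda>(w, z). q w z) \<in> borel_measurable (\<mu> \<Otimes>\<^sub>M \<mu>)"
    and density_nonneg: "\<And>w z. w \<in> space \<mu> \<Longrightarrow> z \<in> space \<mu> \<Longrightarrow> 0 \<le> q w z"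
    and density_total: "\<And>z. z \<in> space \<mu> \<Longrightarrow> (\<integral>\<^sup>+w. ennreal (q w z) \<partial>\<mu>) = 1"
begin

text \<open>For \<open>p = (z\<^sub>0, z\<^sub>1)\<close>, the density of the signed measure \<open>Q(\<cdot> | z\<^sub>0) - Q(\<cdot> | z\<^sub>1)\<close>.\<close>

definition diff :: "'z \<times> 'z \<Rightarrow> 'z \<Rightarrow> real" where
  "diff p w = q w (fst p) - q w (snd p)"

lemma space_P: "space P = space \<mu> \<times> space \<mu>"
  using sets_eq_imp_space_eq[OF sets_P] by (simp add: space_pair_measure)

lemma measurable_density_section [measurable]:
  "z \<in> space \<mu> \<Longrightarrow> (\<lambda>w. q w z) \<in> borel_measurable \<mu>"
  using measurable_compose[OF measurable_Pair2' density_measurable, of z] by simp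

lemma integrable_density: "z \<in> space \<mu> \<Longrightarrow> integrable \<mu> (\<lambda>w. q w z)"
  by (rule integrableI_nonneg) (auto simp: density_total density_nonneg)

lemma measurable_diff_pair:
  "(\<lambda>(p, w). diff p w) \<in> borel_measurable ((\<mu> \<Otimes>\<^sub>M \<mu>) \<Otimes>\<^sub>M \<mu>)"
proof -
  have "(\<lambda>x. case (snd x, fst (fst x)) of (w, z) \<Rightarrow> q w z) \<in> borel_measurable ((\<mu> \<Otimes>\<^sub>M \<mu>) \<Otimes>\<^sub>M \<mu>)"
    and "(\<lambda>x. case (snd x, snd (fst x)) of (w, z) \<Rightarrow> q w z) \<in> borel_measurable ((\<mu> \<Otimes>\<^sub>M \<mu>) \<Otimes>\<^sub>M \<mu>)"
    by (rule measurable_compose[OF _ density_measurable]; measurable)+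
  then show ?thesis
    by (simp add: diff_def split_beta)
qed

lemma measurable_diff [measurable]:
  assumes "f \<in> N \<rightarrow>\<^sub>M P" and "g \<in> N \<rightarrow>\<^sub>M \<mu>"
  shows "(\<lambda>x. diff (f x) (g x)) \<in> borel_measurable N"
proof -
  have "f \<in> N \<rightarrow>\<^sub>M \<mu> \<Otimes>\<^sub>M \<mu>"
    using assms(1) measurable_cong_sets[OF refl sets_P] by blast
  then have "(\<lambda>x. (f x, g x)) \<in> N \<rightarrow>\<^sub>M (\<mu> \<Otimes>\<^sub>M \<mu>) \<Otimes>\<^sub>M \<mu>"
    using assms(2) by measurable
  from measurable_compose[OF this measurable_diff_pair] show ?thesis by simp
qed

lemma measurable_diff_section [measurable]:
  "p \<in> space P \<Longrightarrow> diff p \<in> borel_measurable \<mu>"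
  using measurable_diff[of "\<lambda>_. p" \<mu> "\<lambda>w. w"] by simp

lemma integrable_diff: "p \<in> space P \<Longrightarrow> integrable \<mu> (diff p)"
  unfolding diff_def by (intro Bochner_Integration.integrable_diff integrable_density)
    (auto simp: space_P)

lemma nn_integral_diff_le:
  assumes "p \<in> space P"
  shows "(\<integral>\<^sup>+w. ennreal \<bar>diff p w\<bar> \<partial>\<mu>) \<le> 2"
proof -
  have p: "fst p \<in> space \<mu>" "snd p \<in> space \<mu>"
    using assms by (auto simp: space_P)
  have "(\<integral>\<^sup>+w. ennreal \<bar>diff p w\<bar> \<partial>\<mu>)
      \<le> (\<integral>\<^sup>+w. ennreal (q w (fst p)) + ennreal (q w (snd p)) \<partial>\<mu>)"
    using p density_nonneg
    by (intro nn_integral_mono) (auto simp: diff_def abs_le_iff simp flip: ennreal_plus)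
  also have "\<dots> = 1 + 1"
    using p by (subst nn_integral_add) (auto simp: density_total)
  finally show ?thesis by (simp add: one_add_one)
qed

lemma integrable_diff_prod:
  "integrable (P \<Otimes>\<^sub>M (\<mu> \<Otimes>\<^sub>M \<mu>)) (\<lambda>(p, w, w'). diff p w * diff p w')"
proof (rule integrableI_bounded)
  interpret M: sigma_finite_measure \<mu> by (rule sigma_finite_base)
  interpret P: prob_space P by (rule prob_P)
  interpret MM: pair_sigma_finite \<mu> \<mu> ..
  show "(\<lambda>(p, w, w'). diff p w * diff p w') \<in> borel_measurable (P \<Otimes>\<^sub>M (\<mu> \<Otimes>\<^sub>M \<mu>))"
    by measurable
  have section_le: "(\<integral>\<^sup>+x. ennreal \<bar>diff p (fst x) * diff p (snd x)\<bar> \<partial>(\<mu> \<Otimes>\<^sub>M \<mu>)) \<le> 2 * 2"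
    if p: "p \<in> space P" for p
  proof -
    have [measurable]: "diff p \<in> borel_measurable \<mu>" using p by simp
    have "(\<integral>\<^sup>+x. ennreal \<bar>diff p (fst x) * diff p (snd x)\<bar> \<partial>(\<mu> \<Otimes>\<^sub>M \<mu>))
        = (\<integral>\<^sup>+w. \<integral>\<^sup>+w'. ennreal \<bar>diff p w\<bar> * ennreal \<bar>diff p w'\<bar> \<partial>\<mu> \<partial>\<mu>)"
      by (subst M.nn_integral_fst[symmetric]) (auto simp: abs_mult ennreal_mult)
    also have "\<dots> = (\<integral>\<^sup>+w. ennreal \<bar>diff p w\<bar> \<partial>\<mu>) * (\<integral>\<^sup>+w. ennreal \<bar>diff p w\<bar> \<partial>\<mu>)"
      by (simp add: nn_integral_cmult nn_integral_multc)
    also have "\<dots> \<le> 2 * 2"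
      using nn_integral_diff_le[OF p] by (intro mult_mono) auto
    finally show ?thesis .
  qed
  have "(\<integral>\<^sup>+x. ennreal (norm (case x of (p, w, w') \<Rightarrow> diff p w * diff p w'))
          \<partial>(P \<Otimes>\<^sub>M (\<mu> \<Otimes>\<^sub>M \<mu>)))
      = (\<integral>\<^sup>+p. \<integral>\<^sup>+x. ennreal \<bar>diff p (fst x) * diff p (snd x)\<bar> \<partial>(\<mu> \<Otimes>\<^sub>M \<mu>) \<partial>P)"
    by (subst MM.nn_integral_fst[symmetric]) (auto simp: split_beta)
  also have "\<dots> \<le> (\<integral>\<^sup>+p. 2 * 2 \<partial>P)"
    using section_le by (intro nn_integral_mono) auto
  also have "\<dots> < \<infinity>"
    by (simp add: P.emeasure_space_1 ennreal_mult_less_top)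
  finally show "(\<integral>\<^sup>+x. ennreal (norm (case x of (p, w, w') \<Rightarrow> diff p w * diff p w'))
          \<partial>(P \<Otimes>\<^sub>M (\<mu> \<Otimes>\<^sub>M \<mu>))) < \<infinity>" .
qed

section \<open>Integrability of the kernel and finiteness of the operator norm\<close>

lemma kernel_eq: "kernel P q w w' = (\<integral>p. diff p w * diff p w' \<partial>P)"
  by (simp add: kernel_def diff_def case_prod_unfold)

lemma integrable_kernel: "integrable (\<mu> \<Otimes>\<^sub>M \<mu>) (\<lambda>(w, w'). kernel P q w w')"
proof -
  interpret M: sigma_finite_measure \<mu> by (rule sigma_finite_base)
  interpret P: prob_space P by (rule prob_P)
  interpret MM: pair_sigma_finite \<mu> \<mu> ..
  interpret PM: pair_sigma_finite P "\<mu> \<Otimes>\<^sub>M \<mu>" ..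
  show ?thesis
    using PM.integrable_snd[of "\<lambda>p (w, w'). diff p w * diff p w'"] integrable_diff_prod
    by (simp add: kernel_eq case_prod_unfold)
qed

lemma measurable_kernel [measurable]:
  "(\<lambda>(w, w'). kernel P q w w') \<in> borel_measurable (\<mu> \<Otimes>\<^sub>M \<mu>)"
  using integrable_kernel by (rule borel_measurable_integrable)

lemma opnorm_finite:
  "opnorm_Linf_L1 \<mu>
     (integral_op \<mu> P q :: ('z \<Rightarrow> 'h::{real_inner, banach, second_countable_topology}) \<Rightarrow> 'z \<Rightarrow> 'h) < \<infinity>"
proof -
  interpret M: sigma_finite_measure \<mu> by (rule sigma_finite_base)
  interpret MM: pair_sigma_finite \<mu> \<mu> ..
  let ?B = "\<integral>\<^sup>+x. ennreal (norm (case x of (w, w') \<Rightarrow> kernel P q w w')) \<partial>(\<mu> \<Otimes>\<^sub>M \<mu>)"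
  have "L1_norm \<mu> (integral_op \<mu> P q f) \<le> ?B"
    if [measurable]: "f \<in> borel_measurable \<mu>" and f: "Linf_norm \<mu> f \<le> 1" for f :: "'z \<Rightarrow> 'h"
  proof -
    have f_le: "norm (f w) \<le> 1" if "w \<in> space \<mu>" for w
      using order_trans[OF SUP_upper f[unfolded Linf_norm_def], OF that]
      by simp
    have "L1_norm \<mu> (integral_op \<mu> P q f)
        \<le> (\<integral>\<^sup>+w. \<integral>\<^sup>+w'. ennreal (norm (kernel P q w w' *\<^sub>R f w')) \<partial>\<mu> \<partial>\<mu>)"
      unfolding L1_norm_def integral_op_def
      by (intro nn_integral_mono norm_integral_le_nn_integral_norm)
    also have "\<dots> \<le> (\<integral>\<^sup>+w. \<integral>\<^sup>+w'. ennreal \<bar>kernel P q w w'\<bar> \<partial>\<mu> \<partial>\<mu>)"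
      by (intro nn_integral_mono) (auto intro!: mult_left_le f_le)
    also have "\<dots> = ?B"
      by (subst M.nn_integral_fst[symmetric]) auto
    finally show ?thesis .
  qed
  then have "opnorm_Linf_L1 \<mu> (integral_op \<mu> P q :: ('z \<Rightarrow> 'h) \<Rightarrow> 'z \<Rightarrow> 'h) \<le> ?B"
    unfolding opnorm_Linf_L1_def by (intro SUP_least) auto
  also have "?B < \<infinity>"
    using integrable_kernel by (simp add: integrable_iff_bounded)
  finally show ?thesis .
qed

section \<open>The quadratic form of the integral operator\<close>

context
  fixes f :: "'z \<Rightarrow> 'h::{real_inner, banach, second_countable_topology}"
  assumes f_measurable [measurable]: "f \<in> borel_measurable \<mu>"
    and f_le: "\<And>w. w \<in> space \<mu> \<Longrightarrow> norm (f w) \<le> 1"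
begin

lemma abs_inner_le_1:
  assumes "w \<in> space \<mu>" "w' \<in> space \<mu>" shows "\<bar>f w \<bullet> f w'\<bar> \<le> 1"
proof -
  have "\<bar>f w \<bullet> f w'\<bar> \<le> norm (f w) * norm (f w')" by (rule Cauchy_Schwarz_ineq2)
  also have "\<dots> \<le> 1 * 1" using assms by (intro mult_mono f_le) auto
  finally show ?thesis by simp
qed

lemma integrable_diff_scaleR:
  assumes p: "p \<in> space P" shows "integrable \<mu> (\<lambda>w. diff p w *\<^sub>R f w)"
proof (rule Bochner_Integration.integrable_bound[OF integrable_diff[OF p]])
  show "(\<lambda>w. diff p w *\<^sub>R f w) \<in> borel_measurable \<mu>"
    using measurable_diff_section[OF p] by measurable
  show "AE w in \<mu>. norm (diff p w *\<^sub>R f w) \<le> norm (diff p w)"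
    by (auto intro!: AE_I2 mult_left_le f_le)
qed

lemma integrable_diff_prod_inner:
  "integrable (P \<Otimes>\<^sub>M (\<mu> \<Otimes>\<^sub>M \<mu>)) (\<lambda>(p, w, w'). diff p w * diff p w' * (f w \<bullet> f w'))"
proof (rule Bochner_Integration.integrable_bound[OF integrable_diff_prod])
  show "(\<lambda>(p, w, w'). diff p w * diff p w' * (f w \<bullet> f w'))
      \<in> borel_measurable (P \<Otimes>\<^sub>M (\<mu> \<Otimes>\<^sub>M \<mu>))"
    by measurable
  show "AE x in P \<Otimes>\<^sub>M (\<mu> \<Otimes>\<^sub>M \<mu>).
      norm (case x of (p, w, w') \<Rightarrow> diff p w * diff p w' * (f w \<bullet> f w'))
      \<le> norm (case x of (p, w, w') \<Rightarrow> diff p w * diff p w')"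
    using abs_inner_le_1
    by (intro AE_I2) (auto simp: space_pair_measure abs_mult intro!: mult_left_le)
qed

lemma integrable_kernel_inner:
  "integrable (\<mu> \<Otimes>\<^sub>M \<mu>) (\<lambda>(w, w'). kernel P q w w' * (f w \<bullet> f w'))"
proof (rule Bochner_Integration.integrable_bound[OF integrable_kernel])
  show "(\<lambda>(w, w'). kernel P q w w' * (f w \<bullet> f w')) \<in> borel_measurable (\<mu> \<Otimes>\<^sub>M \<mu>)"
    by measurable
  show "AE x in \<mu> \<Otimes>\<^sub>M \<mu>. norm (case x of (w, w') \<Rightarrow> kernel P q w w' * (f w \<bullet> f w'))
      \<le> norm (case x of (w, w') \<Rightarrow> kernel P q w w')"
    using abs_inner_le_1
    by (intro AE_I2) (auto simp: space_pair_measure abs_mult intro!: mult_left_le)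
qed

lemma integrable_kernel_scaleR:
  "integrable (\<mu> \<Otimes>\<^sub>M \<mu>) (\<lambda>(w, w'). kernel P q w w' *\<^sub>R f w')"
proof (rule Bochner_Integration.integrable_bound[OF integrable_kernel])
  show "(\<lambda>(w, w'). kernel P q w w' *\<^sub>R f w') \<in> borel_measurable (\<mu> \<Otimes>\<^sub>M \<mu>)"
    by measurable
  show "AE x in \<mu> \<Otimes>\<^sub>M \<mu>. norm (case x of (w, w') \<Rightarrow> kernel P q w w' *\<^sub>R f w')
      \<le> norm (case x of (w, w') \<Rightarrow> kernel P q w w')"
    by (intro AE_I2) (auto simp: space_pair_measure intro!: mult_left_le f_le)
qed

lemma integral_diff_prod_inner:
  assumes p: "p \<in> space P"
    and int: "integrable (\<mu> \<Otimes>\<^sub>M \<mu>) (\<lambda>(w, w'). diff p w * diff p w' * (f w \<bullet> f w'))"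
  shows "(\<integral>(w, w'). diff p w * diff p w' * (f w \<bullet> f w') \<partial>(\<mu> \<Otimes>\<^sub>M \<mu>))
       = (norm (\<integral>w. diff p w *\<^sub>R f w \<partial>\<mu>))\<^sup>2"
proof -
  interpret M: sigma_finite_measure \<mu> by (rule sigma_finite_base)
  interpret MM: pair_sigma_finite \<mu> \<mu> ..
  let ?v = "\<integral>w. diff p w *\<^sub>R f w \<partial>\<mu>"
  note I = integrable_diff_scaleR[OF p]
  have "(\<integral>(w, w'). diff p w * diff p w' * (f w \<bullet> f w') \<partial>(\<mu> \<Otimes>\<^sub>M \<mu>))
      = (\<integral>w. (\<integral>w'. (diff p w *\<^sub>R f w) \<bullet> (diff p w' *\<^sub>R f w') \<partial>\<mu>) \<partial>\<mu>)"
    using MM.integral_fst[OF int] by (simp add: mult_ac)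
  also have "\<dots> = (\<integral>w. (diff p w *\<^sub>R f w) \<bullet> ?v \<partial>\<mu>)"
    using integral_inner_right[OF I] by (simp del: inner_scaleR_left inner_scaleR_right)
  also have "\<dots> = ?v \<bullet> ?v"
    using integral_inner_left[OF I] by (simp del: inner_scaleR_left inner_scaleR_right)
  finally show ?thesis by (simp add: power2_norm_eq_inner)
qed

text \<open>
  Fubini's theorem supplies the integrability hypothesis of \<open>integral_diff_prod_inner\<close> for almost
  every \<open>p\<close>, which suffices under the integral over \<open>P\<close>.
\<close>

lemma AE_integral_diff_prod_inner:
  "AE p in P. (\<integral>(w, w'). diff p w * diff p w' * (f w \<bullet> f w') \<partial>(\<mu> \<Otimes>\<^sub>M \<mu>))
       = (norm (\<integral>w. diff p w *\<^sub>R f w \<partial>\<mu>))\<^sup>2"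
proof -
  interpret M: sigma_finite_measure \<mu> by (rule sigma_finite_base)
  interpret P: prob_space P by (rule prob_P)
  interpret MM: pair_sigma_finite \<mu> \<mu> ..
  interpret PM: pair_sigma_finite P "\<mu> \<Otimes>\<^sub>M \<mu>" ..
  have "AE p in P. integrable (\<mu> \<Otimes>\<^sub>M \<mu>) (\<lambda>(w, w'). diff p w * diff p w' * (f w \<bullet> f w'))"
    using PM.AE_integrable_fst[of "\<lambda>p (w, w'). diff p w * diff p w' * (f w \<bullet> f w')"]
      integrable_diff_prod_inner by simp
  then show ?thesis
    using AE_space by eventually_elim (rule integral_diff_prod_inner)
qed

lemma measurable_integral_diff [measurable]:
  "(\<lambda>p. \<integral>w. diff p w *\<^sub>R f w \<partial>\<mu>) \<in> borel_measurable P"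
proof -
  interpret M: sigma_finite_measure \<mu> by (rule sigma_finite_base)
  show ?thesis by measurable
qed

text \<open>
  The inner integral defining \<open>T f\<close> commutes with the inner product only for almost every \<open>w\<close>,
  namely where \<open>K(w, \<cdot>) f\<close> is integrable.
\<close>

lemma expectation_sq_eq_quadratic_form:
  "(\<integral>\<^sup>+p. ennreal ((norm (\<integral>w. diff p w *\<^sub>R f w \<partial>\<mu>))\<^sup>2) \<partial>P)
    = ennreal (\<integral>w. f w \<bullet> integral_op \<mu> P q f w \<partial>\<mu>)"
proof -
  interpret M: sigma_finite_measure \<mu> by (rule sigma_finite_base)
  interpret P: prob_space P by (rule prob_P)
  interpret MM: pair_sigma_finite \<mu> \<mu> ..
  interpret PM: pair_sigma_finite P "\<mu> \<Otimes>\<^sub>M \<mu>" ..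
  let ?G = "\<lambda>p (w, w'). diff p w * diff p w' * (f w \<bullet> f w')"
  let ?n = "\<lambda>p. (norm (\<integral>w. diff p w *\<^sub>R f w \<partial>\<mu>))\<^sup>2"
  have G: "integrable (P \<Otimes>\<^sub>M (\<mu> \<Otimes>\<^sub>M \<mu>)) (\<lambda>(p, x). ?G p x)"
    using integrable_diff_prod_inner by simp
  have [measurable]: "(\<lambda>p. \<integral>x. ?G p x \<partial>(\<mu> \<Otimes>\<^sub>M \<mu>)) \<in> borel_measurable P"
    using PM.integrable_fst[OF G] by (rule borel_measurable_integrable)
  have "integrable P ?n"
    using PM.integrable_fst[OF G] AE_integral_diff_prod_inner
    by (subst integrable_cong_AE[where g = "\<lambda>p. \<integral>x. ?G p x \<partial>(\<mu> \<Otimes>\<^sub>M \<mu>)"]) auto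
  then have "(\<integral>\<^sup>+p. ennreal (?n p) \<partial>P) = ennreal (\<integral>p. ?n p \<partial>P)"
    by (intro nn_integral_eq_integral) auto
  also have "(\<integral>p. ?n p \<partial>P) = (\<integral>p. (\<integral>x. ?G p x \<partial>(\<mu> \<Otimes>\<^sub>M \<mu>)) \<partial>P)"
    using AE_integral_diff_prod_inner by (intro integral_cong_AE) auto
  also have "\<dots> = (\<integral>x. (\<integral>p. ?G p x \<partial>P) \<partial>(\<mu> \<Otimes>\<^sub>M \<mu>))"
    using PM.Fubini_integral[OF G] by simp
  also have "\<dots> = (\<integral>(w, w'). kernel P q w w' * (f w \<bullet> f w') \<partial>(\<mu> \<Otimes>\<^sub>M \<mu>))"
    by (simp add: kernel_eq case_prod_unfold)
  also have "\<dots> = (\<integral>w. (\<integral>w'. kernel P q w w' * (f w \<bullet> f w') \<partial>\<mu>) \<partial>\<mu>)"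
    using MM.integral_fst[OF integrable_kernel_inner] by simp
  also have "\<dots> = (\<integral>w. f w \<bullet> integral_op \<mu> P q f w \<partial>\<mu>)"
  proof (rule integral_cong_AE)
    show "AE w in \<mu>. (\<integral>w'. kernel P q w w' * (f w \<bullet> f w') \<partial>\<mu>) = f w \<bullet> integral_op \<mu> P q f w"
      using MM.AE_integrable_fst[OF integrable_kernel_scaleR]
    proof eventually_elim
      case (elim w)
      then show ?case
        using integral_inner_right[of "f w" \<mu> "\<lambda>w'. kernel P q w w' *\<^sub>R f w'"]
        by (simp add: integral_op_def)
    qed
  qed (unfold integral_op_def, measurable)
  finally show ?thesis .
qed

lemma expectation_sq_le_opnorm:
  "(\<integral>\<^sup>+p. ennreal ((norm (\<integral>w. diff p w *\<^sub>R f w \<partial>\<mu>))\<^sup>2) \<partial>P)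
    \<le> opnorm_Linf_L1 \<mu> (integral_op \<mu> P q :: ('z \<Rightarrow> 'h) \<Rightarrow> 'z \<Rightarrow> 'h)"
proof -
  let ?T = "integral_op \<mu> P q :: ('z \<Rightarrow> 'h) \<Rightarrow> 'z \<Rightarrow> 'h"
  have "ennreal (\<integral>w. f w \<bullet> ?T f w \<partial>\<mu>) \<le> ennreal (norm (\<integral>w. f w \<bullet> ?T f w \<partial>\<mu>))"
    by (intro ennreal_leI) simp
  also have "\<dots> \<le> (\<integral>\<^sup>+w. ennreal (norm (f w \<bullet> ?T f w)) \<partial>\<mu>)"
    by (rule norm_integral_le_nn_integral_norm)
  also have "\<dots> \<le> L1_norm \<mu> (?T f)"
    unfolding L1_norm_def
  proof (intro nn_integral_mono ennreal_leI)
    fix w assume w: "w \<in> space \<mu>"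
    have "norm (f w \<bullet> ?T f w) \<le> norm (f w) * norm (?T f w)"
      using Cauchy_Schwarz_ineq2 by simp
    also have "\<dots> \<le> norm (?T f w)"
      using f_le[OF w] by (intro mult_left_le_one_le) auto
    finally show "norm (f w \<bullet> ?T f w) \<le> norm (?T f w)" .
  qed
  also have "\<dots> \<le> opnorm_Linf_L1 \<mu> ?T"
    unfolding opnorm_Linf_L1_def
    by (intro SUP_upper) (auto simp: Linf_norm_def f_le intro!: SUP_least)
  finally show ?thesis
    by (simp add: expectation_sq_eq_quadratic_form)
qed

end

section \<open>The stability bound\<close>

text \<open>
  Centring at \<open>c\<close> and rescaling reduces the bound to functions of supremum norm at most 1.
\<close>

lemma stability_sq_le:
  fixes A :: "'z \<Rightarrow> 'h::{real_inner, banach, second_countable_topology}"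
  assumes Q: "\<And>z. z \<in> space \<mu> \<Longrightarrow> Q z = density \<mu> (\<lambda>w. ennreal (q w z))"
    and A [measurable]: "A \<in> borel_measurable \<mu>"
    and r: "0 < r" and A_le: "\<And>w. w \<in> space \<mu> \<Longrightarrow> norm (A w - c) \<le> r"
  shows "stability_sq P (ensembled Q A)
    \<le> ennreal (r\<^sup>2) * opnorm_Linf_L1 \<mu> (integral_op \<mu> P q :: ('z \<Rightarrow> 'h) \<Rightarrow> 'z \<Rightarrow> 'h)"
proof -
  define g where "g w = (1 / r) *\<^sub>R (A w - c)" for w
  have A_eq: "A w = r *\<^sub>R g w + c" for w
    using r by (simp add: g_def)
  have g_measurable [measurable]: "g \<in> borel_measurable \<mu>"
    unfolding g_def by measurable
  have g_le: "norm (g w) \<le> 1" if "w \<in> space \<mu>" for w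
    using A_le[OF that] r by (simp add: g_def)
  have integrable_g: "integrable \<mu> (\<lambda>w. q w z *\<^sub>R g w)" if z: "z \<in> space \<mu>" for z
    by (rule Bochner_Integration.integrable_bound[OF integrable_density[OF z]])
      (use z in \<open>auto intro!: AE_I2 mult_left_le g_le\<close>)
  have ensembled_eq: "ensembled Q A z = r *\<^sub>R (\<integral>w. q w z *\<^sub>R g w \<partial>\<mu>) + c"
    if z: "z \<in> space \<mu>" for z
  proof -
    have one: "(\<integral>w. q w z \<partial>\<mu>) = 1"
      using density_total[OF z] z density_nonneg
      by (subst integral_eq_nn_integral) auto
    have "ensembled Q A z = (\<integral>w. q w z *\<^sub>R A w \<partial>\<mu>)"
      unfolding ensembled_def Q[OF z] using z density_nonneg
      by (subst integral_density) auto
    also have "\<dots> = (\<integral>w. r *\<^sub>R (q w z *\<^sub>R g w) + q w z *\<^sub>R c \<partial>\<mu>)"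
      by (simp add: A_eq scaleR_add_right mult.commute)
    also have "\<dots> = r *\<^sub>R (\<integral>w. q w z *\<^sub>R g w \<partial>\<mu>) + (\<integral>w. q w z \<partial>\<mu>) *\<^sub>R c"
      using integrable_g[OF z] integrable_density[OF z]
      by (simp only: Bochner_Integration.integral_add integral_scaleR_right integral_scaleR_left
          integrable_scaleR_right integrable_scaleR_left)
    finally show ?thesis by (simp add: one)
  qed
  have [measurable]: "(\<lambda>p. \<integral>w. diff p w *\<^sub>R g w \<partial>\<mu>) \<in> borel_measurable P"
    by (intro measurable_integral_diff g_measurable g_le)
  have "stability_sq P (ensembled Q A)
      = (\<integral>\<^sup>+p. ennreal (r\<^sup>2) * ennreal ((norm (\<integral>w. diff p w *\<^sub>R g w \<partial>\<mu>))\<^sup>2) \<partial>P)"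
    unfolding stability_sq_def
  proof (rule nn_integral_cong)
    fix p assume p: "p \<in> space P"
    then obtain z0 z1 where p_eq: "p = (z0, z1)" and z: "z0 \<in> space \<mu>" "z1 \<in> space \<mu>"
      by (auto simp: space_P)
    have "ensembled Q A z0 - ensembled Q A z1 = r *\<^sub>R (\<integral>w. diff p w *\<^sub>R g w \<partial>\<mu>)"
      using integrable_g z
      by (simp add: ensembled_eq p_eq diff_def scaleR_diff_left scaleR_diff_right)
    then show "(case p of (z, z') \<Rightarrow> ennreal ((norm (ensembled Q A z - ensembled Q A z'))\<^sup>2))
        = ennreal (r\<^sup>2) * ennreal ((norm (\<integral>w. diff p w *\<^sub>R g w \<partial>\<mu>))\<^sup>2)"
      by (simp add: p_eq power_mult_distrib ennreal_mult)
  qed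
  also have "\<dots> = ennreal (r\<^sup>2) * (\<integral>\<^sup>+p. ennreal ((norm (\<integral>w. diff p w *\<^sub>R g w \<partial>\<mu>))\<^sup>2) \<partial>P)"
    by (intro nn_integral_cmult) measurable
  also have "\<dots> \<le> ennreal (r\<^sup>2) * opnorm_Linf_L1 \<mu> (integral_op \<mu> P q :: ('z \<Rightarrow> 'h) \<Rightarrow> 'z \<Rightarrow> 'h)"
    by (intro mult_left_mono expectation_sq_le_opnorm g_le g_measurable) auto
  finally show ?thesis .
qed

end

text \<open>Finiteness of \<open>N\<close> matters: for \<open>R = 0\<close> and \<open>N = \<infinity>\<close> the bound on the right would be 0.\<close>

lemma ennreal_le_sq_mult_limit:
  fixes x R N :: ennreal
  assumes N: "N < \<infinity>" and R: "R < \<infinity>"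
    and le: "\<And>r. 0 < r \<Longrightarrow> R < ennreal r \<Longrightarrow> x \<le> ennreal (r\<^sup>2) * N"
  shows "x \<le> R\<^sup>2 * N"
proof -
  obtain n where n: "N = ennreal n" "0 \<le> n" using N by (cases N) auto
  obtain s where s: "R = ennreal s" "0 \<le> s" using R by (cases R) auto
  have "(\<lambda>k. ennreal ((s + 1 / real (Suc k))\<^sup>2 * n)) \<longlonglongrightarrow> ennreal ((s + 0)\<^sup>2 * n)"
    by (intro tendsto_ennrealI tendsto_intros LIMSEQ_Suc lim_1_over_n)
  moreover have "x \<le> ennreal ((s + 1 / real (Suc k))\<^sup>2 * n)" for k
    using le[of "s + 1 / real (Suc k)"] s n
    by (simp add: ennreal_mult add_nonneg_pos ennreal_less_iff)
  ultimately have "x \<le> ennreal ((s + 0)\<^sup>2 * n)"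
    by (intro LIMSEQ_le_const) auto
  then show ?thesis
    using s n by (simp add: ennreal_mult ennreal_power)
qed

theorem theorem10:
  fixes \<mu> :: "'z measure"
    and P :: "('z \<times> 'z) measure"
    and Q :: "'z \<Rightarrow> 'z measure"
    and q :: "'z \<Rightarrow> 'z \<Rightarrow> real"
    and W :: "'h::{real_inner, banach, second_countable_topology} set"
    and A :: "'z \<Rightarrow> 'h"
  assumes "sigma_finite_measure \<mu>"
    and "prob_space P" and "sets P = sets (\<mu> \<Otimes>\<^sub>M \<mu>)"
    and "Q \<in> \<mu> \<rightarrow>\<^sub>M prob_algebra \<mu>"
    and "(\<lambda>(w, z). q w z) \<in> borel_measurable (\<mu> \<Otimes>\<^sub>M \<mu>)"
    and "\<And>w z. w \<in> space \<mu> \<Longrightarrow> z \<in> space \<mu> \<Longrightarrow> 0 \<le> q w z"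
    and "\<And>z. z \<in> space \<mu> \<Longrightarrow> Q z = density \<mu> (\<lambda>w. ennreal (q w z))"
    and "convex W" and "closed W" and "radius W < \<infinity>"
    and "A \<in> borel_measurable \<mu>" and "A \<in> space \<mu> \<rightarrow> W"
  shows "stability_sq P (ensembled Q A)
           \<le> (radius W)\<^sup>2 * opnorm_Linf_L1 \<mu> (integral_op \<mu> P q :: ('z \<Rightarrow> 'h) \<Rightarrow> 'z \<Rightarrow> 'h)"
proof -
  have total: "(\<integral>\<^sup>+w. ennreal (q w z) \<partial>\<mu>) = 1" if z: "z \<in> space \<mu>" for z
  proof -
    have "prob_space (Q z)"
      using measurable_space[OF assms(4) z] by (simp add: space_prob_algebra)
    then have "emeasure (density \<mu> (\<lambda>w. ennreal (q w z))) (space \<mu>) = 1"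
      using prob_space.emeasure_space_1[of "Q z"] assms(7)[OF z] by simp
    moreover have "(\<lambda>w. q w z) \<in> borel_measurable \<mu>"
      using measurable_compose[OF measurable_Pair2'[OF z] assms(5)] by simp
    ultimately show ?thesis
      by (simp add: emeasure_density cong: nn_integral_cong)
  qed
  interpret channel_density \<mu> P q
    by (rule channel_density.intro[OF assms(1-3,5,6) total])
  show ?thesis
  proof (rule ennreal_le_sq_mult_limit[OF opnorm_finite assms(10)])
    fix r :: real
    assume r: "0 < r" and "radius W < ennreal r"
    then obtain c where c: "(SUP w\<in>W. ennreal (norm (c - w))) < ennreal r"
      unfolding radius_def by (auto simp: INF_less_iff)
    have A_le: "norm (A w - c) \<le> r" if "w \<in> space \<mu>" for w
    proof -
      have "A w \<in> W" using assms(12) that by auto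
      then have "ennreal (norm (c - A w)) < ennreal r"
        by (rule le_less_trans[OF SUP_upper c])
      then show ?thesis
        by (simp add: norm_minus_commute ennreal_less_iff)
    qed
    show "stability_sq P (ensembled Q A)
        \<le> ennreal (r\<^sup>2) * opnorm_Linf_L1 \<mu> (integral_op \<mu> P q :: ('z \<Rightarrow> 'h) \<Rightarrow> 'z \<Rightarrow> 'h)"
      by (rule stability_sq_le) (fact assms(7,11) r A_le)+
  qed
qed

end
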